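(* Let $L$ be one of $IvFDE_{T4}$, $IvFDE_{T45}$, $IvFDE_{TB}$, $IvFDE_{T4B}$, $IvFDE_{T5}$. (1) For every set of formulas $\Gamma\cup\{\varphi\}$ over $\Sigma_4=\{\land,\lor,\to,\neg\}$: $\Gamma\vdash_L\varphi$ iff $\Gamma\vdash_{\mathcal{IDM}4}\varphi$. (2) For every set of formulas $\Gamma\cup\{\varphi\}$ over $\Sigma_m=\{\to,\sim,\square\}$: (2.1) $\Gamma\vdash_{IvFDE_{T4}}\varphi$ iff $\Gamma\vdash_{T4m}\varphi$; (2.2) $\Gamma\vdash_{IvFDE_{T45}}\varphi$ iff $\Gamma\vdash_{T45m}\varphi$; (2.3) $\Gamma\vdash_{IvFDE_{TB}}\varphi$ iff $\Gamma\vdash_{TBm}\varphi$; (2.4) $\Gamma\vdash_{IvFDE_{T4B}}\varphi$ iff $\Gamma\vdash_{T4Bm}\varphi$; (2.5) $\Gamma\vdash_{IvFDE_{T5}}\varphi$ iff $\Gamma\vdash_{T5m}\varphi$.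
   Context: Formulas are built from a countable set of propositional variables. All calculi below have modus ponens as their only rule. $\mathcal{IDM}4$ is the calculus over $\Sigma_4$ in which $\alpha\leftrightarrow\beta$ is $(\alpha\to\beta)\land(\beta\to\alpha)$, with axiom schemas: - $\varphi\to(\psi\to\varphi)$; - $(\varphi\to(\psi\to\gamma))\to((\varphi\to\psi)\to(\varphi\to\gamma))$; - $\varphi\to(\psi\to(\varphi\land\psi))$; - $(\varphi\land\psi)\to\varphi$; - $(\varphi\land\psi)\to\psi$; - $\varphi\to(\varphi\lor\psi)$; - $\psi\to(\varphi\lor\psi)$; - $(\varphi\to\gamma)\to((\psi\to\gamma)\to((\varphi\lor\psi)\to\gamma))$; - $\neg\neg\varphi\leftrightarrow\varphi$; - $\neg(\varphi\lor\psi)\leftrightarrow(\neg\varphi\land\neg\psi)$; - $\neg(\varphi\land\psi)\leftrightarrow(\neg\varphi\lor\neg\psi)$; - $\neg(\varphi\to\psi)\leftrightarrow(\varphi\land\neg\psi)$; - $\varphi\lor(\varphi\to\psi)$. $Tm$ is the calculus over $\Sigma_m$ in which $\alpha\lor\beta:=\sim\alpha\to\beta$, $\alpha\land\beta:=\sim(\alpha\to\sim\beta)$ and $\alpha\leftrightarrow\beta:=\sim((\alpha\to\beta)\to\sim(\beta\to\alpha))$. Its axiom schemas are: - $\varphi\to(\psi\to\varphi)$; - $(\varphi\to(\psi\to\gamma))\to((\varphi\to\psi)\to(\varphi\to\gamma))$; - $(\sim\psi\to\sim\varphi)\to((\sim\psi\to\varphi)\to\psi)$; - (K) $\square(\varphi\to\psi)\to(\square\varphi\to\square\psi)$;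 - (K1) $\square(\varphi\to\psi)\to(\square\sim\psi\to\square\sim\varphi)$; - (K2) $\square\sim(\varphi\to\psi)\leftrightarrow(\square\varphi\land\square\sim\psi)$; - (M1) $(\square\sim\varphi\lor\square\psi)\to\square(\varphi\to\psi)$; - (T) $\square\varphi\to\varphi$; - (DN1) $\square\varphi\leftrightarrow\square\sim\sim\varphi$. $IvFDE_T$ is the calculus over $\Sigma=\{\land,\lor,\to,\neg,\sim,\square\}$, with $\land,\lor$ primitive and $\leftrightarrow$ read as in $\mathcal{IDM}4$. Its axioms are all the axioms of $\mathcal{IDM}4$ and of $Tm$ (read in this signature), plus: - $\square(\varphi\land\psi)\leftrightarrow(\square\varphi\land\square\psi)$; - $\square\sim(\varphi\lor\psi)\leftrightarrow\square(\sim\varphi\land\sim\psi)$; - $(\square\sim\varphi\lor\square\sim\psi)\to\square\sim(\varphi\land\psi)$; - $(\square\varphi\lor\square\psi)\to\square(\varphi\lor\psi)$; - $\square\varphi\leftrightarrow\square\sim\neg\varphi$; - $\square\sim\varphi\leftrightarrow\square\sim\neg\neg\varphi$; - $\square\sim(\varphi\land\psi)\to(\square\varphi\to\square\sim\psi)$; - $\square\sim(\varphi\land\psi)\to(\square\psi\to\square\sim\varphi)$; - $\square(\varphi\lor\psi)\to(\square\sim\varphi\to\square\psi)$; - $\square(\varphi\lor\psi)\to(\square\sim\psi\to\square\varphi)$. Modal axiom schemas: - (4) $\square\varphi\to\square\square\varphi$; - (5) $\sim\square\sim\square\varphi\to\square\varphi$; - (B) $\sim\square\sim\square\varphi\to\varphi$.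 The calculi $T4m$, $T45m$, $TBm$, $T4Bm$, $T5m$ are $Tm$ plus, respectively, (4); (4) and (5); (B); (B) and (4); (5). The calculi $IvFDE_{T4}$, $IvFDE_{T45}$, $IvFDE_{TB}$, $IvFDE_{T4B}$, $IvFDE_{T5}$ are $IvFDE_T$ plus the same respective axioms. *)

theory Defs
  imports Main
begin

text \<open>
  Formulas over the full signature. The formulas over \<open>\<Sigma>\<^sub>4\<close> and \<open>\<Sigma>\<^sub>m\<close> are the subsets \<open>Fm4\<close> and
  \<open>Fmm\<close>. The operator \<open>\<^bold>\<not>\<close> is the paraconsistent negation (negation of \<open>\<Sigma>\<^sub>4\<close>), whereas \<open>\<^bold>\<sim>\<close> is
  the classical negation of \<open>\<Sigma>\<^sub>m\<close>.
\<close>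

datatype fm =
    Var nat
  | Conj fm fm  (infixr \<open>\<^bold>\<and>\<close> 67)
  | Disj fm fm  (infixr \<open>\<^bold>\<or>\<close> 66)
  | Imp fm fm  (infixr \<open>\<^bold>\<rightarrow>\<close> 65)
  | Neg fm  (\<open>\<^bold>\<not> _\<close> [70] 70)
  | Comp fm  (\<open>\<^bold>\<sim> _\<close> [70] 70)
  | Box fm  (\<open>\<^bold>\<box> _\<close> [70] 70)

inductive_set Fm4 :: "fm set" where
  "Var n \<in> Fm4"
| "\<lbrakk>\<phi> \<in> Fm4; \<psi> \<in> Fm4\<rbrakk> \<Longrightarrow> \<phi> \<^bold>\<and> \<psi> \<in> Fm4"
| "\<lbrakk>\<phi> \<in> Fm4; \<psi> \<in> Fm4\<rbrakk> \<Longrightarrow> \<phi> \<^bold>\<or> \<psi> \<in> Fm4"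
| "\<lbrakk>\<phi> \<in> Fm4; \<psi> \<in> Fm4\<rbrakk> \<Longrightarrow> \<phi> \<^bold>\<rightarrow> \<psi> \<in> Fm4"
| "\<phi> \<in> Fm4 \<Longrightarrow> \<^bold>\<not> \<phi> \<in> Fm4"

inductive_set Fmm :: "fm set" where
  "Var n \<in> Fmm"
| "\<lbrakk>\<phi> \<in> Fmm; \<psi> \<in> Fmm\<rbrakk> \<Longrightarrow> \<phi> \<^bold>\<rightarrow> \<psi> \<in> Fmm"
| "\<phi> \<in> Fmm \<Longrightarrow> \<^bold>\<sim> \<phi> \<in> Fmm"
| "\<phi> \<in> Fmm \<Longrightarrow> \<^bold>\<box> \<phi> \<in> Fmm"

abbreviation Iff :: "fm \<Rightarrow> fm \<Rightarrow> fm" (infixr \<open>\<^bold>\<leftrightarrow>\<close> 64) where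
  "\<alpha> \<^bold>\<leftrightarrow> \<beta> \<equiv> (\<alpha> \<^bold>\<rightarrow> \<beta>) \<^bold>\<and> (\<beta> \<^bold>\<rightarrow> \<alpha>)"

text \<open>The connectives that are defined, rather than primitive, in \<open>Tm\<close>.\<close>

abbreviation disj_m :: "fm \<Rightarrow> fm \<Rightarrow> fm" where
  "disj_m \<alpha> \<beta> \<equiv> \<^bold>\<sim> \<alpha> \<^bold>\<rightarrow> \<beta>"

abbreviation conj_m :: "fm \<Rightarrow> fm \<Rightarrow> fm" where
  "conj_m \<alpha> \<beta> \<equiv> \<^bold>\<sim> (\<alpha> \<^bold>\<rightarrow> \<^bold>\<sim> \<beta>)"

abbreviation iff_m :: "fm \<Rightarrow> fm \<Rightarrow> fm" where
  "iff_m \<alpha> \<beta> \<equiv> \<^bold>\<sim> ((\<alpha> \<^bold>\<rightarrow> \<beta>) \<^bold>\<rightarrow> \<^bold>\<sim> (\<beta> \<^bold>\<rightarrow> \<alpha>))"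

text \<open>
  A calculus is given by its set \<open>Ax\<close> of axiom instances. Since modus ponens is the only rule,
  derivations from premises and axioms in \<open>Fm4\<close> (or \<open>Fmm\<close>) never leave \<open>Fm4\<close> (or \<open>Fmm\<close>).
\<close>

inductive derives :: "fm set \<Rightarrow> fm set \<Rightarrow> fm \<Rightarrow> bool" (\<open>(_ \<turnstile>\<^bsub>_\<^esub> _)\<close> [51, 0, 51] 50)
  for \<Gamma> :: "fm set" and Ax :: "fm set" where
  premise: "\<phi> \<in> \<Gamma> \<Longrightarrow> \<Gamma> \<turnstile>\<^bsub>Ax\<^esub> \<phi>"
| "axiom": "\<phi> \<in> Ax \<Longrightarrow> \<Gamma> \<turnstile>\<^bsub>Ax\<^esub> \<phi>"
| mp: "\<lbrakk>\<Gamma> \<turnstile>\<^bsub>Ax\<^esub> \<phi> \<^bold>\<rightarrow> \<psi>; \<Gamma> \<turnstile>\<^bsub>Ax\<^esub> \<phi>\<rbrakk> \<Longrightarrow> \<Gamma> \<turnstile>\<^bsub>Ax\<^esub> \<psi>"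

text \<open>
  Axiom schemas. The parameter \<open>F\<close> is the set of formulas over which the schema letters range:
  \<open>Fm4\<close> or \<open>Fmm\<close> for the calculus over that signature, \<open>UNIV\<close> for the full signature.
\<close>

inductive_set IDM4_axioms :: "fm set \<Rightarrow> fm set" for F :: "fm set" where
  "\<lbrakk>\<phi> \<in> F; \<psi> \<in> F\<rbrakk> \<Longrightarrow> \<phi> \<^bold>\<rightarrow> (\<psi> \<^bold>\<rightarrow> \<phi>) \<in> IDM4_axioms F"
| "\<lbrakk>\<phi> \<in> F; \<psi> \<in> F; \<gamma> \<in> F\<rbrakk> \<Longrightarrow>
     (\<phi> \<^bold>\<rightarrow> (\<psi> \<^bold>\<rightarrow> \<gamma>)) \<^bold>\<rightarrow> ((\<phi> \<^bold>\<rightarrow> \<psi>) \<^bold>\<rightarrow> (\<phi> \<^bold>\<rightarrow> \<gamma>)) \<in> IDM4_axioms F"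
| "\<lbrakk>\<phi> \<in> F; \<psi> \<in> F\<rbrakk> \<Longrightarrow> \<phi> \<^bold>\<rightarrow> (\<psi> \<^bold>\<rightarrow> (\<phi> \<^bold>\<and> \<psi>)) \<in> IDM4_axioms F"
| "\<lbrakk>\<phi> \<in> F; \<psi> \<in> F\<rbrakk> \<Longrightarrow> (\<phi> \<^bold>\<and> \<psi>) \<^bold>\<rightarrow> \<phi> \<in> IDM4_axioms F"
| "\<lbrakk>\<phi> \<in> F; \<psi> \<in> F\<rbrakk> \<Longrightarrow> (\<phi> \<^bold>\<and> \<psi>) \<^bold>\<rightarrow> \<psi> \<in> IDM4_axioms F"
| "\<lbrakk>\<phi> \<in> F; \<psi> \<in> F\<rbrakk> \<Longrightarrow> \<phi> \<^bold>\<rightarrow> (\<phi> \<^bold>\<or> \<psi>) \<in> IDM4_axioms F"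
| "\<lbrakk>\<phi> \<in> F; \<psi> \<in> F\<rbrakk> \<Longrightarrow> \<psi> \<^bold>\<rightarrow> (\<phi> \<^bold>\<or> \<psi>) \<in> IDM4_axioms F"
| "\<lbrakk>\<phi> \<in> F; \<psi> \<in> F; \<gamma> \<in> F\<rbrakk> \<Longrightarrow>
     (\<phi> \<^bold>\<rightarrow> \<gamma>) \<^bold>\<rightarrow> ((\<psi> \<^bold>\<rightarrow> \<gamma>) \<^bold>\<rightarrow> ((\<phi> \<^bold>\<or> \<psi>) \<^bold>\<rightarrow> \<gamma>)) \<in> IDM4_axioms F"
| "\<phi> \<in> F \<Longrightarrow> \<^bold>\<not> \<^bold>\<not> \<phi> \<^bold>\<leftrightarrow> \<phi> \<in> IDM4_axioms F"
| "\<lbrakk>\<phi> \<in> F; \<psi> \<in> F\<rbrakk> \<Longrightarrow> \<^bold>\<not> (\<phi> \<^bold>\<or> \<psi>) \<^bold>\<leftrightarrow> (\<^bold>\<not> \<phi> \<^bold>\<and> \<^bold>\<not> \<psi>) \<in> IDM4_axioms F"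
| "\<lbrakk>\<phi> \<in> F; \<psi> \<in> F\<rbrakk> \<Longrightarrow> \<^bold>\<not> (\<phi> \<^bold>\<and> \<psi>) \<^bold>\<leftrightarrow> (\<^bold>\<not> \<phi> \<^bold>\<or> \<^bold>\<not> \<psi>) \<in> IDM4_axioms F"
| "\<lbrakk>\<phi> \<in> F; \<psi> \<in> F\<rbrakk> \<Longrightarrow> \<^bold>\<not> (\<phi> \<^bold>\<rightarrow> \<psi>) \<^bold>\<leftrightarrow> (\<phi> \<^bold>\<and> \<^bold>\<not> \<psi>) \<in> IDM4_axioms F"
| "\<lbrakk>\<phi> \<in> F; \<psi> \<in> F\<rbrakk> \<Longrightarrow> \<phi> \<^bold>\<or> (\<phi> \<^bold>\<rightarrow> \<psi>) \<in> IDM4_axioms F"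

text \<open>
  The schemas of \<open>Tm\<close> mention disjunction, conjunction and equivalence, which are defined in \<open>\<Sigma>\<^sub>m\<close>
  but come from the primitive connectives in the full signature. They are therefore parameters.
\<close>

inductive_set Tm_schemas ::
  "(fm \<Rightarrow> fm \<Rightarrow> fm) \<Rightarrow> (fm \<Rightarrow> fm \<Rightarrow> fm) \<Rightarrow> (fm \<Rightarrow> fm \<Rightarrow> fm) \<Rightarrow> fm set \<Rightarrow> fm set"
  for dis con iff :: "fm \<Rightarrow> fm \<Rightarrow> fm" and F :: "fm set" where
  "\<lbrakk>\<phi> \<in> F; \<psi> \<in> F\<rbrakk> \<Longrightarrow> \<phi> \<^bold>\<rightarrow> (\<psi> \<^bold>\<rightarrow> \<phi>) \<in> Tm_schemas dis con iff F"
| "\<lbrakk>\<phi> \<in> F; \<psi> \<in> F; \<gamma> \<in> F\<rbrakk> \<Longrightarrow>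
     (\<phi> \<^bold>\<rightarrow> (\<psi> \<^bold>\<rightarrow> \<gamma>)) \<^bold>\<rightarrow> ((\<phi> \<^bold>\<rightarrow> \<psi>) \<^bold>\<rightarrow> (\<phi> \<^bold>\<rightarrow> \<gamma>)) \<in> Tm_schemas dis con iff F"
| "\<lbrakk>\<phi> \<in> F; \<psi> \<in> F\<rbrakk> \<Longrightarrow>
     (\<^bold>\<sim> \<psi> \<^bold>\<rightarrow> \<^bold>\<sim> \<phi>) \<^bold>\<rightarrow> ((\<^bold>\<sim> \<psi> \<^bold>\<rightarrow> \<phi>) \<^bold>\<rightarrow> \<psi>) \<in> Tm_schemas dis con iff F"
| K: "\<lbrakk>\<phi> \<in> F; \<psi> \<in> F\<rbrakk> \<Longrightarrow>
     \<^bold>\<box> (\<phi> \<^bold>\<rightarrow> \<psi>) \<^bold>\<rightarrow> (\<^bold>\<box> \<phi> \<^bold>\<rightarrow> \<^bold>\<box> \<psi>) \<in> Tm_schemas dis con iff F"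
| K1: "\<lbrakk>\<phi> \<in> F; \<psi> \<in> F\<rbrakk> \<Longrightarrow>
     \<^bold>\<box> (\<phi> \<^bold>\<rightarrow> \<psi>) \<^bold>\<rightarrow> (\<^bold>\<box> \<^bold>\<sim> \<psi> \<^bold>\<rightarrow> \<^bold>\<box> \<^bold>\<sim> \<phi>) \<in> Tm_schemas dis con iff F"
| K2: "\<lbrakk>\<phi> \<in> F; \<psi> \<in> F\<rbrakk> \<Longrightarrow>
     iff (\<^bold>\<box> \<^bold>\<sim> (\<phi> \<^bold>\<rightarrow> \<psi>)) (con (\<^bold>\<box> \<phi>) (\<^bold>\<box> \<^bold>\<sim> \<psi>)) \<in> Tm_schemas dis con iff F"
| M1: "\<lbrakk>\<phi> \<in> F; \<psi> \<in> F\<rbrakk> \<Longrightarrow>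
     dis (\<^bold>\<box> \<^bold>\<sim> \<phi>) (\<^bold>\<box> \<psi>) \<^bold>\<rightarrow> \<^bold>\<box> (\<phi> \<^bold>\<rightarrow> \<psi>) \<in> Tm_schemas dis con iff F"
| T: "\<phi> \<in> F \<Longrightarrow> \<^bold>\<box> \<phi> \<^bold>\<rightarrow> \<phi> \<in> Tm_schemas dis con iff F"
| DN1: "\<phi> \<in> F \<Longrightarrow> iff (\<^bold>\<box> \<phi>) (\<^bold>\<box> \<^bold>\<sim> \<^bold>\<sim> \<phi>) \<in> Tm_schemas dis con iff F"

inductive_set IvFDE_extra_axioms :: "fm set" where
  "\<^bold>\<box> (\<phi> \<^bold>\<and> \<psi>) \<^bold>\<leftrightarrow> (\<^bold>\<box> \<phi> \<^bold>\<and> \<^bold>\<box> \<psi>) \<in> IvFDE_extra_axioms"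
| "\<^bold>\<box> \<^bold>\<sim> (\<phi> \<^bold>\<or> \<psi>) \<^bold>\<leftrightarrow> \<^bold>\<box> (\<^bold>\<sim> \<phi> \<^bold>\<and> \<^bold>\<sim> \<psi>) \<in> IvFDE_extra_axioms"
| "(\<^bold>\<box> \<^bold>\<sim> \<phi> \<^bold>\<or> \<^bold>\<box> \<^bold>\<sim> \<psi>) \<^bold>\<rightarrow> \<^bold>\<box> \<^bold>\<sim> (\<phi> \<^bold>\<and> \<psi>) \<in> IvFDE_extra_axioms"
| "(\<^bold>\<box> \<phi> \<^bold>\<or> \<^bold>\<box> \<psi>) \<^bold>\<rightarrow> \<^bold>\<box> (\<phi> \<^bold>\<or> \<psi>) \<in> IvFDE_extra_axioms"
| "\<^bold>\<box> \<phi> \<^bold>\<leftrightarrow> \<^bold>\<box> \<^bold>\<sim> \<^bold>\<not> \<phi> \<in> IvFDE_extra_axioms"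
| "\<^bold>\<box> \<^bold>\<sim> \<phi> \<^bold>\<leftrightarrow> \<^bold>\<box> \<^bold>\<sim> \<^bold>\<not> \<^bold>\<not> \<phi> \<in> IvFDE_extra_axioms"
| "\<^bold>\<box> \<^bold>\<sim> (\<phi> \<^bold>\<and> \<psi>) \<^bold>\<rightarrow> (\<^bold>\<box> \<phi> \<^bold>\<rightarrow> \<^bold>\<box> \<^bold>\<sim> \<psi>) \<in> IvFDE_extra_axioms"
| "\<^bold>\<box> \<^bold>\<sim> (\<phi> \<^bold>\<and> \<psi>) \<^bold>\<rightarrow> (\<^bold>\<box> \<psi> \<^bold>\<rightarrow> \<^bold>\<box> \<^bold>\<sim> \<phi>) \<in> IvFDE_extra_axioms"
| "\<^bold>\<box> (\<phi> \<^bold>\<or> \<psi>) \<^bold>\<rightarrow> (\<^bold>\<box> \<^bold>\<sim> \<phi> \<^bold>\<rightarrow> \<^bold>\<box> \<psi>) \<in> IvFDE_extra_axioms"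
| "\<^bold>\<box> (\<phi> \<^bold>\<or> \<psi>) \<^bold>\<rightarrow> (\<^bold>\<box> \<^bold>\<sim> \<psi> \<^bold>\<rightarrow> \<^bold>\<box> \<phi>) \<in> IvFDE_extra_axioms"

definition axioms_4 :: "fm set \<Rightarrow> fm set" where
  "axioms_4 F = {\<^bold>\<box> \<phi> \<^bold>\<rightarrow> \<^bold>\<box> \<^bold>\<box> \<phi> | \<phi>. \<phi> \<in> F}"

definition axioms_5 :: "fm set \<Rightarrow> fm set" where
  "axioms_5 F = {\<^bold>\<sim> \<^bold>\<box> \<^bold>\<sim> \<^bold>\<box> \<phi> \<^bold>\<rightarrow> \<^bold>\<box> \<phi> | \<phi>. \<phi> \<in> F}"

definition axioms_B :: "fm set \<Rightarrow> fm set" where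
  "axioms_B F = {\<^bold>\<sim> \<^bold>\<box> \<^bold>\<sim> \<^bold>\<box> \<phi> \<^bold>\<rightarrow> \<phi> | \<phi>. \<phi> \<in> F}"

definition IDM4 :: "fm set" where "IDM4 = IDM4_axioms Fm4"

definition Tm :: "fm set" where "Tm = Tm_schemas disj_m conj_m iff_m Fmm"

definition T4m :: "fm set" where "T4m = Tm \<union> axioms_4 Fmm"
definition T45m :: "fm set" where "T45m = Tm \<union> axioms_4 Fmm \<union> axioms_5 Fmm"
definition TBm :: "fm set" where "TBm = Tm \<union> axioms_B Fmm"
definition T4Bm :: "fm set" where "T4Bm = Tm \<union> axioms_B Fmm \<union> axioms_4 Fmm"
definition T5m :: "fm set" where "T5m = Tm \<union> axioms_5 Fmm"

definition IvFDE_T :: "fm set" where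
  "IvFDE_T = IDM4_axioms UNIV \<union> Tm_schemas Disj Conj Iff UNIV \<union> IvFDE_extra_axioms"

definition IvFDE_T4 :: "fm set" where "IvFDE_T4 = IvFDE_T \<union> axioms_4 UNIV"
definition IvFDE_T45 :: "fm set" where "IvFDE_T45 = IvFDE_T \<union> axioms_4 UNIV \<union> axioms_5 UNIV"
definition IvFDE_TB :: "fm set" where "IvFDE_TB = IvFDE_T \<union> axioms_B UNIV"
definition IvFDE_T4B :: "fm set" where "IvFDE_T4B = IvFDE_T \<union> axioms_B UNIV \<union> axioms_4 UNIV"
definition IvFDE_T5 :: "fm set" where "IvFDE_T5 = IvFDE_T \<union> axioms_5 UNIV"

end

theory Submission
  imports Defs
begin

text \<open>
  Every calculus involved is complete with respect to sets \<open>M\<close> of formulas that contain the axioms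
  and treat implication classically, so each conservativity claim amounts to extending such a set
  from the smaller language to the full one. A model of \<open>Tm\<close> extends by reading \<open>\<^bold>\<not>\<close> as \<open>\<^bold>\<sim>\<close> and
  \<open>\<^bold>\<and>\<close>, \<open>\<^bold>\<or>\<close> as the connectives defined from \<open>\<^bold>\<rightarrow>\<close> and \<open>\<^bold>\<sim>\<close>. A model of \<open>IDM4\<close> extends by declaring
  that no literal is necessarily true or necessarily false, and that every formula \<open>\<^bold>\<box> \<phi>\<close> is one or
  the other; this validates (4), (5) and (B) simultaneously.
\<close>

section \<open>Completeness\<close>

lemma derives_mono:
  assumes "\<Gamma> \<turnstile>\<^bsub>Ax\<^esub> \<phi>" "\<Gamma> \<subseteq> \<Delta>" "\<And>\<alpha>. \<alpha> \<in> Ax \<Longrightarrow> \<Delta> \<turnstile>\<^bsub>Ax'\<^esub> \<alpha>"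
  shows "\<Delta> \<turnstile>\<^bsub>Ax'\<^esub> \<phi>"
  using assms by induction (blast intro: derives.intros)+

lemma derives_closed:
  assumes "\<Gamma> \<turnstile>\<^bsub>Ax\<^esub> \<phi>" "\<Gamma> \<subseteq> M" "Ax \<subseteq> M"
    and "\<And>\<alpha> \<beta>. \<lbrakk>\<alpha> \<^bold>\<rightarrow> \<beta> \<in> M; \<alpha> \<in> M\<rbrakk> \<Longrightarrow> \<beta> \<in> M"
  shows "\<phi> \<in> M"
  using assms by induction blast+

text \<open>At each modus ponens the two subderivations draw on two members of the chain; these are
  comparable, so the larger one serves both. An axiom still needs some member, hence
  \<open>C\<close> is nonempty.\<close>

lemma derives_chain:
  assumes "\<Union>C \<turnstile>\<^bsub>Ax\<^esub> \<phi>" "C \<noteq> {}" "subset.chain A C"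
  shows "\<exists>\<Delta>\<in>C. \<Delta> \<turnstile>\<^bsub>Ax\<^esub> \<phi>"
  using assms
proof (induction)
  case (mp \<phi> \<psi>)
  then obtain X Y where XY: "X \<in> C" "Y \<in> C" "X \<turnstile>\<^bsub>Ax\<^esub> \<phi> \<^bold>\<rightarrow> \<psi>" "Y \<turnstile>\<^bsub>Ax\<^esub> \<phi>"
    by auto
  then have "X \<subseteq> Y \<or> Y \<subseteq> X"
    using mp.prems by (auto simp: subset.chain_def)
  then show ?case
    using XY by (metis derives_mono derives.axiom derives.mp)
next
  case (premise \<phi>)
  then show ?case
    by (meson UnionE derives.premise)
next
  case ("axiom" \<phi>)
  then show ?case
    by (meson all_not_in_conv derives.axiom)
qed

text \<open>The language \<open>F\<close> is closed under implication in both directions: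
  derivations stay inside \<open>F\<close>, and the constituents of a derivable implication are
  again in \<open>F\<close>, which makes the schema instances built from them available.\<close>

locale calculus =
  fixes F Ax :: "fm set"
  assumes Imp_iff: "\<phi> \<^bold>\<rightarrow> \<psi> \<in> F \<longleftrightarrow> \<phi> \<in> F \<and> \<psi> \<in> F"
    and Ax_sub: "Ax \<subseteq> F"
    and weakening: "\<lbrakk>\<phi> \<in> F; \<psi> \<in> F\<rbrakk> \<Longrightarrow> \<phi> \<^bold>\<rightarrow> (\<psi> \<^bold>\<rightarrow> \<phi>) \<in> Ax"
    and distribution: "\<lbrakk>\<phi> \<in> F; \<psi> \<in> F; \<gamma> \<in> F\<rbrakk> \<Longrightarrow>
      (\<phi> \<^bold>\<rightarrow> (\<psi> \<^bold>\<rightarrow> \<gamma>)) \<^bold>\<rightarrow> ((\<phi> \<^bold>\<rightarrow> \<psi>) \<^bold>\<rightarrow> (\<phi> \<^bold>\<rightarrow> \<gamma>)) \<in> Ax"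
begin

lemma derives_in:
  assumes "\<Gamma> \<turnstile>\<^bsub>Ax\<^esub> \<phi>" "\<Gamma> \<subseteq> F"
  shows "\<phi> \<in> F"
  using assms Ax_sub by (rule derives_closed) (simp add: Imp_iff)

lemma weaken:
  assumes "\<Gamma> \<turnstile>\<^bsub>Ax\<^esub> \<psi>" "\<Gamma> \<subseteq> F" "\<phi> \<in> F"
  shows "\<Gamma> \<turnstile>\<^bsub>Ax\<^esub> \<phi> \<^bold>\<rightarrow> \<psi>"
proof (rule derives.mp)
  show "\<Gamma> \<turnstile>\<^bsub>Ax\<^esub> \<psi> \<^bold>\<rightarrow> (\<phi> \<^bold>\<rightarrow> \<psi>)"
    using assms derives_in by (intro derives.axiom weakening)
qed (rule assms)

lemma derives_refl:
  assumes "\<phi> \<in> F"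
  shows "\<Gamma> \<turnstile>\<^bsub>Ax\<^esub> \<phi> \<^bold>\<rightarrow> \<phi>"
proof -
  have "\<Gamma> \<turnstile>\<^bsub>Ax\<^esub>
    (\<phi> \<^bold>\<rightarrow> ((\<phi> \<^bold>\<rightarrow> \<phi>) \<^bold>\<rightarrow> \<phi>)) \<^bold>\<rightarrow> ((\<phi> \<^bold>\<rightarrow> (\<phi> \<^bold>\<rightarrow> \<phi>)) \<^bold>\<rightarrow> (\<phi> \<^bold>\<rightarrow> \<phi>))"
    using assms by (intro derives.axiom distribution) (simp_all add: Imp_iff)
  moreover have "\<Gamma> \<turnstile>\<^bsub>Ax\<^esub> \<phi> \<^bold>\<rightarrow> ((\<phi> \<^bold>\<rightarrow> \<phi>) \<^bold>\<rightarrow> \<phi>)" "\<Gamma> \<turnstile>\<^bsub>Ax\<^esub> \<phi> \<^bold>\<rightarrow> (\<phi> \<^bold>\<rightarrow> \<phi>)"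
    using assms by (auto intro!: derives.axiom weakening simp: Imp_iff)
  ultimately show ?thesis
    by (blast intro: derives.mp)
qed

lemma deduction:
  assumes "insert \<phi> \<Gamma> \<turnstile>\<^bsub>Ax\<^esub> \<psi>" "\<Gamma> \<subseteq> F" "\<phi> \<in> F"
  shows "\<Gamma> \<turnstile>\<^bsub>Ax\<^esub> \<phi> \<^bold>\<rightarrow> \<psi>"
  using assms
proof (induction)
  case (premise \<psi>)
  then show ?case
    by (metis derives.premise derives_refl insert_iff weaken)
next
  case ("axiom" \<psi>)
  then show ?case
    by (simp add: derives.axiom weaken)
next
  case (mp \<alpha> \<beta>)
  \<comment> \<open>\<open>distribution\<close> may only be instantiated inside \<open>F\<close>;
    membership of the derived implication puts \<alpha> and \<beta> there.\<close>
  then have "\<alpha> \<^bold>\<rightarrow> \<beta> \<in> F"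
    using derives_in[of "insert \<phi> \<Gamma>"] by auto
  then show ?case
    using mp distribution[of \<phi> \<alpha> \<beta>] Imp_iff by (blast intro: derives.intros)
qed

end

text \<open>Case distinction between \<alpha> and \<alpha> \<rightarrow> \<beta>, phrased as a rule
  in implication alone. It thus covers both languages: one has a primitive disjunction but no
  classical negation, the other has the reverse.\<close>

locale classical_calculus = calculus +
  assumes dichotomy: "\<lbrakk>\<Gamma> \<turnstile>\<^bsub>Ax\<^esub> \<alpha> \<^bold>\<rightarrow> \<gamma>; \<Gamma> \<turnstile>\<^bsub>Ax\<^esub> (\<alpha> \<^bold>\<rightarrow> \<beta>) \<^bold>\<rightarrow> \<gamma>; \<Gamma> \<subseteq> F\<rbrakk> \<Longrightarrow> \<Gamma> \<turnstile>\<^bsub>Ax\<^esub> \<gamma>"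

locale model =
  fixes F Ax M :: "fm set"
  assumes Ax_in: "Ax \<subseteq> M"
    and Imp_in: "\<lbrakk>\<alpha> \<in> F; \<beta> \<in> F\<rbrakk> \<Longrightarrow> \<alpha> \<^bold>\<rightarrow> \<beta> \<in> M \<longleftrightarrow> (\<alpha> \<in> M \<longrightarrow> \<beta> \<in> M)"

text \<open>Lindenbaum's argument relative to \<phi>: Zorn's lemma gives a set \<open>M\<close>
  maximal among the extensions of \<Gamma> within \<open>F\<close> that do not derive \<phi>. By the
  deduction theorem every formula of \<open>F\<close> outside \<open>M\<close> implies \<phi> over
  \<open>M\<close>.\<close>

lemma (in classical_calculus) completeness:
  assumes "\<not> (\<Gamma> \<turnstile>\<^bsub>Ax\<^esub> \<phi>)" "\<Gamma> \<subseteq> F" "\<phi> \<in> F"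
  obtains M where "model F Ax M" "\<Gamma> \<subseteq> M" "\<phi> \<notin> M"
proof -
  define A where "A = {\<Delta>. \<Gamma> \<subseteq> \<Delta> \<and> \<Delta> \<subseteq> F \<and> \<not> (\<Delta> \<turnstile>\<^bsub>Ax\<^esub> \<phi>)}"
  have "\<exists>M\<in>A. \<forall>X\<in>A. M \<subseteq> X \<longrightarrow> X = M"
  proof (rule subset_Zorn_nonempty)
    show "A \<noteq> {}"
      using assms by (auto simp: A_def)
    fix C assume C: "C \<noteq> {}" "subset.chain A C"
    then have "C \<subseteq> A"
      by (simp add: subset.chain_def)
    then show "\<Union>C \<in> A"
      using C derives_chain[OF _ C] unfolding A_def by blast
  qed
  then obtain M where M: "\<Gamma> \<subseteq> M" "M \<subseteq> F" "\<not> (M \<turnstile>\<^bsub>Ax\<^esub> \<phi>)"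
    and max: "\<And>X. X \<in> A \<Longrightarrow> M \<subseteq> X \<Longrightarrow> X = M"
    by (auto simp: A_def)
  have out: "M \<turnstile>\<^bsub>Ax\<^esub> \<alpha> \<^bold>\<rightarrow> \<phi>" if "\<alpha> \<notin> M" "\<alpha> \<in> F" for \<alpha>
  proof -
    have "insert \<alpha> M \<turnstile>\<^bsub>Ax\<^esub> \<phi>"
      using max[of "insert \<alpha> M"] M that by (auto simp: A_def)
    then show ?thesis
      using M that by (intro deduction) auto
  qed
  have closed: "\<alpha> \<in> M" if "M \<turnstile>\<^bsub>Ax\<^esub> \<alpha>" for \<alpha>
    using out[of \<alpha>] that M derives_in by (blast intro: derives.mp)
  have "model F Ax M"
  proof
    show "Ax \<subseteq> M"
      using closed by (auto intro: derives.axiom)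
    fix \<alpha> \<beta> assume F: "\<alpha> \<in> F" "\<beta> \<in> F"
    show "\<alpha> \<^bold>\<rightarrow> \<beta> \<in> M \<longleftrightarrow> (\<alpha> \<in> M \<longrightarrow> \<beta> \<in> M)"
    proof
      assume "\<alpha> \<^bold>\<rightarrow> \<beta> \<in> M"
      then show "\<alpha> \<in> M \<longrightarrow> \<beta> \<in> M"
        by (meson closed derives.mp derives.premise)
    next
      assume imp: "\<alpha> \<in> M \<longrightarrow> \<beta> \<in> M"
      show "\<alpha> \<^bold>\<rightarrow> \<beta> \<in> M"
      proof (cases "\<alpha> \<in> M")
        case True
        then show ?thesis
          using imp F M closed weaken by (blast intro: derives.premise)
      next
        \<comment> \<open>If \<alpha> \<rightarrow> \<beta> were outside \<open>M\<close> as well,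
          both \<alpha> and \<alpha> \<rightarrow> \<beta> would imply \<phi> over \<open>M\<close>,
          and \<open>dichotomy\<close> would derive \<phi>.\<close>
        case False
        then show ?thesis
          using out F M dichotomy Imp_iff by blast
      qed
    qed
  qed
  moreover have "\<phi> \<notin> M"
    using M(3) derives.premise by blast
  ultimately show thesis
    using M(1) that by simp
qed

lemma model_sound:
  assumes "\<Gamma> \<turnstile>\<^bsub>Ax\<^esub> \<phi>" "\<Gamma> \<subseteq> M" "model UNIV Ax M"
  shows "\<phi> \<in> M"
  using assms(1,2) model.Ax_in[OF assms(3)]
proof (rule derives_closed)
  show "\<beta> \<in> M" if "\<alpha> \<^bold>\<rightarrow> \<beta> \<in> M" "\<alpha> \<in> M" for \<alpha> \<beta>
    using that model.Imp_in[OF assms(3), of \<alpha> \<beta>] by simp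
qed

lemma model_subset: "\<lbrakk>model F Ax M; Ax' \<subseteq> Ax\<rbrakk> \<Longrightarrow> model F Ax' M"
  by (auto simp: model_def)

section \<open>Classicality of the calculi and of their models\<close>

lemma Imp_Fm4 [simp]: "\<phi> \<^bold>\<rightarrow> \<psi> \<in> Fm4 \<longleftrightarrow> \<phi> \<in> Fm4 \<and> \<psi> \<in> Fm4"
  by (auto intro: Fm4.intros elim: Fm4.cases)

lemma Imp_Fmm [simp]: "\<phi> \<^bold>\<rightarrow> \<psi> \<in> Fmm \<longleftrightarrow> \<phi> \<in> Fmm \<and> \<psi> \<in> Fmm"
  by (auto intro: Fmm.intros elim: Fmm.cases)

lemma Comp_Fmm [simp]: "\<^bold>\<sim> \<phi> \<in> Fmm \<longleftrightarrow> \<phi> \<in> Fmm"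
  by (auto intro: Fmm.intros elim: Fmm.cases)

lemma Box_Fmm [simp]: "\<^bold>\<box> \<phi> \<in> Fmm \<longleftrightarrow> \<phi> \<in> Fmm"
  by (auto intro: Fmm.intros elim: Fmm.cases)

text \<open>The axiom \<alpha> \<or> (\<alpha> \<rightarrow> \<beta>) followed by disjunction
  elimination. With \<open>F\<close> and \<open>Ax\<close> left general this serves
  \<open>IDM4\<close> over \<open>Fm4\<close> and also the calculi over the full language.\<close>

lemma classical_calculus_IDM4:
  assumes F: "\<And>\<phi> \<psi>. \<phi> \<^bold>\<rightarrow> \<psi> \<in> F \<longleftrightarrow> \<phi> \<in> F \<and> \<psi> \<in> F" and "IDM4_axioms F \<subseteq> Ax" "Ax \<subseteq> F"
  shows "classical_calculus F Ax"
proof -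
  interpret calculus F Ax
    using assms by unfold_locales (auto intro: IDM4_axioms.intros)
  show ?thesis
  proof
    fix \<Gamma> \<alpha> \<beta> \<gamma>
    assume 1: "\<Gamma> \<turnstile>\<^bsub>Ax\<^esub> \<alpha> \<^bold>\<rightarrow> \<gamma>" "\<Gamma> \<turnstile>\<^bsub>Ax\<^esub> (\<alpha> \<^bold>\<rightarrow> \<beta>) \<^bold>\<rightarrow> \<gamma>" and "\<Gamma> \<subseteq> F"
    then have "\<alpha> \<in> F" "\<beta> \<in> F" "\<gamma> \<in> F"
      using derives_in F by blast+
    then have "\<Gamma> \<turnstile>\<^bsub>Ax\<^esub> \<alpha> \<^bold>\<or> (\<alpha> \<^bold>\<rightarrow> \<beta>)"
      and "\<Gamma> \<turnstile>\<^bsub>Ax\<^esub> (\<alpha> \<^bold>\<rightarrow> \<gamma>) \<^bold>\<rightarrow> (((\<alpha> \<^bold>\<rightarrow> \<beta>) \<^bold>\<rightarrow> \<gamma>) \<^bold>\<rightarrow> (\<alpha> \<^bold>\<or> (\<alpha> \<^bold>\<rightarrow> \<beta>) \<^bold>\<rightarrow> \<gamma>))"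
      using assms by (auto intro!: derives.axiom set_mp[OF assms(2)] IDM4_axioms.intros)
    then show "\<Gamma> \<turnstile>\<^bsub>Ax\<^esub> \<gamma>"
      using 1 by (blast intro: derives.mp)
  qed
qed

text \<open>The third schema is proof by contradiction. Under the assumption \<sim> \<gamma>, the
  first premise refutes \<alpha>; hence \<alpha> \<rightarrow> \<beta> holds by explosion, and the
  second premise yields \<gamma>.\<close>

lemma classical_calculus_Tm:
  assumes "Tm \<subseteq> Ax" "Ax \<subseteq> Fmm"
  shows "classical_calculus Fmm Ax"
proof -
  interpret calculus Fmm Ax
    using assms by unfold_locales (auto simp: Tm_def intro: Tm_schemas.intros)
  have contra: "\<Gamma> \<turnstile>\<^bsub>Ax\<^esub> \<psi>"
    if "\<Gamma> \<turnstile>\<^bsub>Ax\<^esub> \<^bold>\<sim> \<psi> \<^bold>\<rightarrow> \<^bold>\<sim> \<phi>" "\<Gamma> \<turnstile>\<^bsub>Ax\<^esub> \<^bold>\<sim> \<psi> \<^bold>\<rightarrow> \<phi>" "\<Gamma> \<subseteq> Fmm" for \<Gamma> \<phi> \<psi>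
  proof -
    have "\<phi> \<in> Fmm" "\<psi> \<in> Fmm"
      using that derives_in by fastforce+
    then have "(\<^bold>\<sim> \<psi> \<^bold>\<rightarrow> \<^bold>\<sim> \<phi>) \<^bold>\<rightarrow> ((\<^bold>\<sim> \<psi> \<^bold>\<rightarrow> \<phi>) \<^bold>\<rightarrow> \<psi>) \<in> Ax"
      using assms by (auto simp: Tm_def intro: Tm_schemas.intros)
    then show ?thesis
      using that by (blast intro: derives.intros)
  qed
  show ?thesis
  proof
    fix \<Gamma> \<alpha> \<beta> \<gamma>
    assume 1: "\<Gamma> \<turnstile>\<^bsub>Ax\<^esub> \<alpha> \<^bold>\<rightarrow> \<gamma>" "\<Gamma> \<turnstile>\<^bsub>Ax\<^esub> (\<alpha> \<^bold>\<rightarrow> \<beta>) \<^bold>\<rightarrow> \<gamma>" and \<Gamma>: "\<Gamma> \<subseteq> Fmm"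
    then have F: "\<alpha> \<in> Fmm" "\<beta> \<in> Fmm" "\<gamma> \<in> Fmm"
      using derives_in by fastforce+
    define \<Delta> where "\<Delta> = insert (\<^bold>\<sim> \<gamma>) \<Gamma>"
    have \<Delta>: "\<Delta> \<subseteq> Fmm"
      using \<Gamma> F by (simp add: \<Delta>_def)
    have mono: "X \<turnstile>\<^bsub>Ax\<^esub> \<phi>" if "\<Gamma> \<turnstile>\<^bsub>Ax\<^esub> \<phi>" "\<Gamma> \<subseteq> X" for X \<phi>
      using derives_mono that derives.axiom by blast
    \<comment> \<open>Deriving \<sim> \<alpha> by \<open>contra\<close> means refuting \<sim> \<sim>
      \<alpha>, so double negation elimination is needed first.\<close>
    have "insert (\<^bold>\<sim> \<^bold>\<sim> \<alpha>) \<Delta> \<turnstile>\<^bsub>Ax\<^esub> \<alpha>"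
      using F \<Delta> by (intro contra[of _ \<alpha> "\<^bold>\<sim> \<alpha>"]) (auto intro: weaken derives_refl derives.premise)
    moreover have "insert (\<^bold>\<sim> \<^bold>\<sim> \<alpha>) \<Delta> \<turnstile>\<^bsub>Ax\<^esub> \<alpha> \<^bold>\<rightarrow> \<gamma>"
      by (rule mono[OF 1(1)]) (auto simp: \<Delta>_def)
    ultimately have "\<Delta> \<turnstile>\<^bsub>Ax\<^esub> \<^bold>\<sim> \<^bold>\<sim> \<alpha> \<^bold>\<rightarrow> \<gamma>"
      using F \<Delta> by (intro deduction) (auto intro: derives.mp)
    moreover have "\<Delta> \<turnstile>\<^bsub>Ax\<^esub> \<^bold>\<sim> \<^bold>\<sim> \<alpha> \<^bold>\<rightarrow> \<^bold>\<sim> \<gamma>"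
      using F \<Delta> by (intro weaken derives.premise) (auto simp: \<Delta>_def)
    ultimately have na: "\<Delta> \<turnstile>\<^bsub>Ax\<^esub> \<^bold>\<sim> \<alpha>"
      using contra \<Delta> by blast
    have "insert \<alpha> \<Delta> \<turnstile>\<^bsub>Ax\<^esub> \<^bold>\<sim> \<alpha>"
      using derives_mono[OF na, of "insert \<alpha> \<Delta>" Ax] derives.axiom by blast
    then have "insert \<alpha> \<Delta> \<turnstile>\<^bsub>Ax\<^esub> \<beta>"
      using F \<Delta> by (intro contra[of _ \<beta> \<alpha>]) (auto intro: weaken derives.premise)
    then have "\<Delta> \<turnstile>\<^bsub>Ax\<^esub> \<alpha> \<^bold>\<rightarrow> \<beta>"
      using F \<Delta> deduction by blast
    moreover have "\<Delta> \<turnstile>\<^bsub>Ax\<^esub> (\<alpha> \<^bold>\<rightarrow> \<beta>) \<^bold>\<rightarrow> \<gamma>"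
      by (rule mono[OF 1(2)]) (auto simp: \<Delta>_def)
    ultimately have "\<Delta> \<turnstile>\<^bsub>Ax\<^esub> \<gamma>"
      by (blast intro: derives.mp)
    then have "\<Gamma> \<turnstile>\<^bsub>Ax\<^esub> \<^bold>\<sim> \<gamma> \<^bold>\<rightarrow> \<gamma>"
      using F \<Gamma> deduction by (simp add: \<Delta>_def)
    then show "\<Gamma> \<turnstile>\<^bsub>Ax\<^esub> \<gamma>"
      using F \<Gamma> by (intro contra[of _ \<gamma> \<gamma>]) (auto intro: derives_refl)
  qed
qed

text \<open>The formula \<chi> outside \<open>M\<close> excludes the trivial model in which
  everything is true. With \<open>dis\<close>, \<open>con\<close> and \<open>bic\<close> arbitrary,
  the result applies to primitive and to defined connectives.\<close>

lemma Comp_in: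
  assumes M: "model F Ax M" and Ax: "Tm_schemas dis con bic F \<subseteq> Ax"
    and F: "\<And>\<phi>. \<^bold>\<sim> \<phi> \<in> F \<longleftrightarrow> \<phi> \<in> F" "\<And>\<phi> \<psi>. \<phi> \<^bold>\<rightarrow> \<psi> \<in> F \<longleftrightarrow> \<phi> \<in> F \<and> \<psi> \<in> F"
    and \<chi>: "\<chi> \<in> F" "\<chi> \<notin> M" and \<phi>: "\<phi> \<in> F"
  shows "\<^bold>\<sim> \<phi> \<in> M \<longleftrightarrow> \<phi> \<notin> M"
proof -
  have contra: "\<psi> \<in> M" if "\<^bold>\<sim> \<psi> \<in> M \<longrightarrow> \<^bold>\<sim> \<phi> \<in> M \<and> \<phi> \<in> M" "\<phi> \<in> F" "\<psi> \<in> F" for \<phi> \<psi>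
  proof -
    have "(\<^bold>\<sim> \<psi> \<^bold>\<rightarrow> \<^bold>\<sim> \<phi>) \<^bold>\<rightarrow> ((\<^bold>\<sim> \<psi> \<^bold>\<rightarrow> \<phi>) \<^bold>\<rightarrow> \<psi>) \<in> M"
      by (intro subsetD[OF model.Ax_in[OF M]] subsetD[OF Ax] Tm_schemas.intros(3) that)
    then show ?thesis
      using that by (simp add: model.Imp_in[OF M] F)
  qed
  \<comment> \<open>The first instance puts \<phi> or \<sim> \<phi> into \<open>M\<close>; the
    second is explosion, as both together would put \<chi> into \<open>M\<close>.\<close>
  show ?thesis
    using contra[of \<phi> \<phi>] contra[of \<chi> \<phi>] \<phi> \<chi> by argo
qed

section \<open>Conservativity over \<open>IDM4\<close>\<close>

text \<open>
  \<open>determined \<phi> True\<close> and \<open>determined \<phi> False\<close> give the values of \<open>\<^bold>\<box> \<phi>\<close> and \<open>\<^bold>\<box> \<^bold>\<sim> \<phi>\<close>, and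
  \<open>holds M \<phi> True\<close> and \<open>holds M \<phi> False\<close> those of \<open>\<phi>\<close> and \<open>\<^bold>\<not> \<phi>\<close>.
\<close>

primrec determined :: "fm \<Rightarrow> bool \<Rightarrow> bool" where
  "determined (Var p) s \<longleftrightarrow> False"
| "determined (\<phi> \<^bold>\<and> \<psi>) s \<longleftrightarrow>
     (if s then determined \<phi> s \<and> determined \<psi> s else determined \<phi> s \<or> determined \<psi> s)"
| "determined (\<phi> \<^bold>\<or> \<psi>) s \<longleftrightarrow>
     (if s then determined \<phi> s \<or> determined \<psi> s else determined \<phi> s \<and> determined \<psi> s)"
| "determined (\<phi> \<^bold>\<rightarrow> \<psi>) s \<longleftrightarrow>
     (if s then determined \<phi> (\<not> s) \<or> determined \<psi> s else determined \<phi> (\<not> s) \<and> determined \<psi> s)"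
| "determined (\<^bold>\<not> \<phi>) s \<longleftrightarrow> determined \<phi> (\<not> s)"
| "determined (\<^bold>\<sim> \<phi>) s \<longleftrightarrow> determined \<phi> (\<not> s)"
| "determined (\<^bold>\<box> \<phi>) s \<longleftrightarrow> determined \<phi> True = s"

primrec holds :: "fm set \<Rightarrow> fm \<Rightarrow> bool \<Rightarrow> bool" where
  "holds M (Var p) s \<longleftrightarrow> (if s then Var p else \<^bold>\<not> Var p) \<in> M"
| "holds M (\<phi> \<^bold>\<and> \<psi>) s \<longleftrightarrow>
     (if s then holds M \<phi> s \<and> holds M \<psi> s else holds M \<phi> s \<or> holds M \<psi> s)"
| "holds M (\<phi> \<^bold>\<or> \<psi>) s \<longleftrightarrow>
     (if s then holds M \<phi> s \<or> holds M \<psi> s else holds M \<phi> s \<and> holds M \<psi> s)"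
| "holds M (\<phi> \<^bold>\<rightarrow> \<psi>) s \<longleftrightarrow>
     (if s then holds M \<phi> True \<longrightarrow> holds M \<psi> s else holds M \<phi> True \<and> holds M \<psi> s)"
| "holds M (\<^bold>\<not> \<phi>) s \<longleftrightarrow> holds M \<phi> (\<not> s)"
| "holds M (\<^bold>\<sim> \<phi>) s \<longleftrightarrow> holds M \<phi> True \<noteq> s"
| "holds M (\<^bold>\<box> \<phi>) s \<longleftrightarrow> determined \<phi> True = s"

text \<open>A determined formula takes a classical value that is the same for every
  \<open>M\<close>; this is what validates (T).\<close>

lemma determined_holds: "determined \<phi> s \<Longrightarrow> holds M \<phi> s \<and> \<not> holds M \<phi> (\<not> s)"
proof -
  \<comment> \<open>Both signs go through one induction because the negations, and implication in
    its antecedent, exchange them.\<close>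
  have "(determined \<phi> True \<longrightarrow> holds M \<phi> True \<and> \<not> holds M \<phi> False) \<and>
    (determined \<phi> False \<longrightarrow> holds M \<phi> False \<and> \<not> holds M \<phi> True)"
    by (induction \<phi>) auto
  then show "determined \<phi> s \<Longrightarrow> ?thesis"
    by (cases s) auto
qed

text \<open>This gives (K), (K1) and the disjunctive syllogisms under \<box>: when one disjunct is
  determined false it cannot be the one that is determined true.\<close>

lemma determined_consistent: "\<not> (determined \<phi> True \<and> determined \<phi> False)"
  using determined_holds[of \<phi> True] determined_holds[of \<phi> False] by auto

text \<open>A formula \<box> \<phi> is itself always determined, so \<box> \<box> \<phi> and \<sim>
  \<box> \<sim> \<box> \<phi> both have the value of \<box> \<phi>. This yields (4) and (5), and
  with (T) also (B).\<close>

lemma model_holds: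
  "model UNIV (IvFDE_T \<union> axioms_4 UNIV \<union> axioms_5 UNIV \<union> axioms_B UNIV) {\<phi>. holds M \<phi> True}"
proof -
  have T: "holds M \<phi> True" if "determined \<phi> True" for \<phi>
    using that determined_holds by blast
  have "holds M \<phi> True" if "\<phi> \<in> IDM4_axioms UNIV" for \<phi>
    using that by cases auto
  moreover have "holds M \<phi> True" if "\<phi> \<in> Tm_schemas Disj Conj Iff UNIV" for \<phi>
    using that by cases (use T determined_consistent in auto)
  moreover have "holds M \<phi> True" if "\<phi> \<in> IvFDE_extra_axioms" for \<phi>
    using that by cases (use determined_consistent in auto)
  ultimately show ?thesis
    by (auto simp: model_def IvFDE_T_def axioms_4_def axioms_5_def axioms_B_def T)
qed

section \<open>Agreement of the constructed model with the given one on \<open>Fm4\<close>\<close>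

lemma
  assumes M: "model F Ax M" and Ax: "IDM4_axioms F \<subseteq> Ax" and F: "\<phi> \<in> F" "\<psi> \<in> F"
    and Imp: "\<And>\<phi> \<psi>. \<phi> \<^bold>\<rightarrow> \<psi> \<in> F \<longleftrightarrow> \<phi> \<in> F \<and> \<psi> \<in> F"
    and Conj: "\<And>\<phi> \<psi>. \<phi> \<^bold>\<and> \<psi> \<in> F \<longleftrightarrow> \<phi> \<in> F \<and> \<psi> \<in> F"
    and Disj: "\<And>\<phi> \<psi>. \<phi> \<^bold>\<or> \<psi> \<in> F \<longleftrightarrow> \<phi> \<in> F \<and> \<psi> \<in> F"
  shows Conj_in: "\<phi> \<^bold>\<and> \<psi> \<in> M \<longleftrightarrow> \<phi> \<in> M \<and> \<psi> \<in> M"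
    and Disj_in: "\<phi> \<^bold>\<or> \<psi> \<in> M \<longleftrightarrow> \<phi> \<in> M \<or> \<psi> \<in> M"
proof -
  note ax = set_mp[OF subset_trans[OF Ax model.Ax_in[OF M]]]
  note simps = model.Imp_in[OF M] Imp Conj Disj F
  show "\<phi> \<^bold>\<and> \<psi> \<in> M \<longleftrightarrow> \<phi> \<in> M \<and> \<psi> \<in> M"
    using ax[OF IDM4_axioms.intros(3)[OF F]] ax[OF IDM4_axioms.intros(4)[OF F]]
      ax[OF IDM4_axioms.intros(5)[OF F]]
    by (auto simp: simps)
  show "\<phi> \<^bold>\<or> \<psi> \<in> M \<longleftrightarrow> \<phi> \<in> M \<or> \<psi> \<in> M"
    \<comment> \<open>Disjunction elimination is instantiated with a disjunct as conclusion: if both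
      disjuncts are outside \<open>M\<close>, the two implications into it hold vacuously, so the
      disjunction is outside \<open>M\<close> too.\<close>
    using ax[OF IDM4_axioms.intros(6)[OF F]] ax[OF IDM4_axioms.intros(7)[OF F]]
      ax[OF IDM4_axioms.intros(8)[OF F, of "\<phi> \<^bold>\<or> \<psi>"]] ax[OF IDM4_axioms.intros(8)[OF F, of \<phi>]]
      ax[OF IDM4_axioms.intros(8)[OF F, of \<psi>]]
    by (auto simp: simps)
qed

lemma Fm4_iffs [simp]:
  "\<phi> \<^bold>\<and> \<psi> \<in> Fm4 \<longleftrightarrow> \<phi> \<in> Fm4 \<and> \<psi> \<in> Fm4"
  "\<phi> \<^bold>\<or> \<psi> \<in> Fm4 \<longleftrightarrow> \<phi> \<in> Fm4 \<and> \<psi> \<in> Fm4"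
  "\<^bold>\<not> \<phi> \<in> Fm4 \<longleftrightarrow> \<phi> \<in> Fm4"
  by (auto intro: Fm4.intros elim: Fm4.cases)

text \<open>The four axioms on negated formulas compute membership of \<not> \<phi> from the parts
  of \<phi>, exactly as \<open>holds\<close> does. The two claims need each other, since \<not>
  exchanges them and a negated implication refers to the truth of its antecedent.\<close>

lemma holds_Fm4:
  assumes M: "model Fm4 IDM4 M" and "\<phi> \<in> Fm4"
  shows "(holds M \<phi> True \<longleftrightarrow> \<phi> \<in> M) \<and> (holds M \<phi> False \<longleftrightarrow> \<^bold>\<not> \<phi> \<in> M)"
proof -
  have Ax: "IDM4_axioms Fm4 \<subseteq> IDM4"
    by (simp add: IDM4_def)
  have in_M: "\<phi> \<in> M" if "\<phi> \<in> IDM4_axioms Fm4" for \<phi>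
    using that model.Ax_in[OF M] by (auto simp: IDM4_def)
  note [simp] = model.Imp_in[OF M] Conj_in[OF M Ax _ _ Imp_Fm4 Fm4_iffs(1,2)]
    Disj_in[OF M Ax _ _ Imp_Fm4 Fm4_iffs(1,2)]
  have iff: "\<phi> \<in> M \<longleftrightarrow> \<psi> \<in> M"
    if "\<phi> \<^bold>\<leftrightarrow> \<psi> \<in> IDM4_axioms Fm4" "\<phi> \<in> Fm4" "\<psi> \<in> Fm4" for \<phi> \<psi>
    using in_M[OF that(1)] that(2,3) by auto
  have Neg_Conj: "\<^bold>\<not> (\<phi> \<^bold>\<and> \<psi>) \<in> M \<longleftrightarrow> \<^bold>\<not> \<phi> \<in> M \<or> \<^bold>\<not> \<psi> \<in> M" if "\<phi> \<in> Fm4" "\<psi> \<in> Fm4" for \<phi> \<psi>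
    using iff[OF IDM4_axioms.intros(11)[OF that]] that by simp
  have Neg_Disj: "\<^bold>\<not> (\<phi> \<^bold>\<or> \<psi>) \<in> M \<longleftrightarrow> \<^bold>\<not> \<phi> \<in> M \<and> \<^bold>\<not> \<psi> \<in> M" if "\<phi> \<in> Fm4" "\<psi> \<in> Fm4" for \<phi> \<psi>
    using iff[OF IDM4_axioms.intros(10)[OF that]] that by simp
  have Neg_Imp: "\<^bold>\<not> (\<phi> \<^bold>\<rightarrow> \<psi>) \<in> M \<longleftrightarrow> \<phi> \<in> M \<and> \<^bold>\<not> \<psi> \<in> M" if "\<phi> \<in> Fm4" "\<psi> \<in> Fm4" for \<phi> \<psi>
    using iff[OF IDM4_axioms.intros(12)[OF that]] that by simp
  have Neg_Neg: "\<^bold>\<not> \<^bold>\<not> \<phi> \<in> M \<longleftrightarrow> \<phi> \<in> M" if "\<phi> \<in> Fm4" for \<phi>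
    using iff[OF IDM4_axioms.intros(9)[OF that]] that by simp
  show ?thesis
    using assms(2) by induction (simp_all add: Neg_Conj Neg_Disj Neg_Imp Neg_Neg)
qed

lemma IDM4_sub: "IDM4 \<subseteq> Fm4"
proof
  fix \<phi> assume "\<phi> \<in> IDM4"
  then show "\<phi> \<in> Fm4"
    unfolding IDM4_def by cases auto
qed

lemma IDM4_axioms_mono: "F \<subseteq> G \<Longrightarrow> IDM4_axioms F \<subseteq> IDM4_axioms G"
proof
  fix \<phi> assume "F \<subseteq> G" "\<phi> \<in> IDM4_axioms F"
  from this(2,1) show "\<phi> \<in> IDM4_axioms G"
    by cases (blast intro: IDM4_axioms.intros)+
qed

text \<open>The upper bound on \<open>L\<close> contains all three modal schemas, so a single
  extension of a countermodel over \<open>Fm4\<close> treats all five calculi.\<close>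

lemma conservative_IDM4:
  assumes L: "IDM4_axioms UNIV \<subseteq> L" "L \<subseteq> IvFDE_T \<union> axioms_4 UNIV \<union> axioms_5 UNIV \<union> axioms_B UNIV"
    and \<Gamma>: "\<Gamma> \<subseteq> Fm4" and \<phi>: "\<phi> \<in> Fm4"
  shows "(\<Gamma> \<turnstile>\<^bsub>L\<^esub> \<phi>) \<longleftrightarrow> (\<Gamma> \<turnstile>\<^bsub>IDM4\<^esub> \<phi>)"
proof
  assume "\<Gamma> \<turnstile>\<^bsub>IDM4\<^esub> \<phi>"
  moreover have "IDM4 \<subseteq> L"
    using L IDM4_axioms_mono[of Fm4 UNIV] by (auto simp: IDM4_def)
  ultimately show "\<Gamma> \<turnstile>\<^bsub>L\<^esub> \<phi>"
    by (meson derives_mono derives.axiom subset_iff)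
next
  assume der: "\<Gamma> \<turnstile>\<^bsub>L\<^esub> \<phi>"
  interpret classical_calculus Fm4 IDM4
    by (rule classical_calculus_IDM4) (use IDM4_sub in \<open>auto simp: IDM4_def\<close>)
  show "\<Gamma> \<turnstile>\<^bsub>IDM4\<^esub> \<phi>"
  proof (rule ccontr)
    assume "\<not> (\<Gamma> \<turnstile>\<^bsub>IDM4\<^esub> \<phi>)"
    then obtain M where M: "model Fm4 IDM4 M" "\<Gamma> \<subseteq> M" "\<phi> \<notin> M"
      using completeness \<Gamma> \<phi> by metis
    then have "\<Gamma> \<subseteq> {\<phi>. holds M \<phi> True}"
      using holds_Fm4 \<Gamma> by auto
    then have "holds M \<phi> True"
      using model_sound[OF der _ model_subset[OF model_holds L(2)]] by blast
    then show False
      using holds_Fm4 M \<phi> by blast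
  qed
qed

section \<open>Conservativity over the calculi extending \<open>Tm\<close>\<close>

primrec to_m :: "fm \<Rightarrow> fm" where
  "to_m (Var p) = Var p"
| "to_m (\<phi> \<^bold>\<and> \<psi>) = conj_m (to_m \<phi>) (to_m \<psi>)"
| "to_m (\<phi> \<^bold>\<or> \<psi>) = disj_m (to_m \<phi>) (to_m \<psi>)"
| "to_m (\<phi> \<^bold>\<rightarrow> \<psi>) = to_m \<phi> \<^bold>\<rightarrow> to_m \<psi>"
| "to_m (\<^bold>\<not> \<phi>) = \<^bold>\<sim> to_m \<phi>"
| "to_m (\<^bold>\<sim> \<phi>) = \<^bold>\<sim> to_m \<phi>"
| "to_m (\<^bold>\<box> \<phi>) = \<^bold>\<box> to_m \<phi>"

lemma to_m_in [simp]: "to_m \<phi> \<in> Fmm"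
  by (induction \<phi>) (auto intro: Fmm.intros)

lemma to_m_id: "\<phi> \<in> Fmm \<Longrightarrow> to_m \<phi> = \<phi>"
  by (induction rule: Fmm.induct) auto

text \<open>\<chi> makes \<sim> classical in \<open>M\<close>, so the purely propositional axioms
  become tautologies; the boxed ones reduce to the schemas of \<open>Tm\<close>.\<close>

lemma model_to_m:
  assumes M: "model Fmm Ax M" and Ax: "Tm \<subseteq> Ax" and \<chi>: "\<chi> \<in> Fmm" "\<chi> \<notin> M"
    and E: "\<And>\<phi>. \<phi> \<in> E \<Longrightarrow> to_m \<phi> \<in> M"
  shows "model UNIV (IvFDE_T \<union> E) {\<phi>. to_m \<phi> \<in> M}"
proof -
  have in_M: "\<phi> \<in> M" if "\<phi> \<in> Tm_schemas disj_m conj_m iff_m Fmm" for \<phi>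
    using that Ax model.Ax_in[OF M] by (auto simp: Tm_def)
  have [simp]: "\<^bold>\<sim> \<phi> \<in> M \<longleftrightarrow> \<phi> \<notin> M" if "\<phi> \<in> Fmm" for \<phi>
    using Comp_in[OF M Ax[unfolded Tm_def] _ _ \<chi> that] by simp
  note [simp] = model.Imp_in[OF M]
  have K: "\<^bold>\<box> \<phi> \<in> M \<Longrightarrow> \<^bold>\<box> \<psi> \<in> M" if "\<^bold>\<box> (\<phi> \<^bold>\<rightarrow> \<psi>) \<in> M" "\<phi> \<in> Fmm" "\<psi> \<in> Fmm" for \<phi> \<psi>
    using in_M[OF Tm_schemas.K, of \<phi> \<psi>] that by simp
  have K1: "\<^bold>\<box> \<^bold>\<sim> \<psi> \<in> M \<Longrightarrow> \<^bold>\<box> \<^bold>\<sim> \<phi> \<in> M" if "\<^bold>\<box> (\<phi> \<^bold>\<rightarrow> \<psi>) \<in> M" "\<phi> \<in> Fmm" "\<psi> \<in> Fmm" for \<phi> \<psi>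
    using in_M[OF Tm_schemas.K1, of \<phi> \<psi>] that by simp
  have M1: "\<^bold>\<box> (\<phi> \<^bold>\<rightarrow> \<psi>) \<in> M" if "\<^bold>\<box> \<^bold>\<sim> \<phi> \<in> M \<or> \<^bold>\<box> \<psi> \<in> M" "\<phi> \<in> Fmm" "\<psi> \<in> Fmm" for \<phi> \<psi>
    using in_M[OF Tm_schemas.M1, of \<phi> \<psi>] that by auto
  have T: "\<phi> \<in> M" if "\<^bold>\<box> \<phi> \<in> M" "\<phi> \<in> Fmm" for \<phi>
    using in_M[OF Tm_schemas.T, of \<phi>] that by simp
  have K2 [simp]: "\<^bold>\<box> \<^bold>\<sim> (\<phi> \<^bold>\<rightarrow> \<psi>) \<in> M \<longleftrightarrow> \<^bold>\<box> \<phi> \<in> M \<and> \<^bold>\<box> \<^bold>\<sim> \<psi> \<in> M" if "\<phi> \<in> Fmm" "\<psi> \<in> Fmm" for \<phi> \<psi>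
    using in_M[OF Tm_schemas.K2, of \<phi> \<psi>] that by auto
  have DN1 [simp]: "\<^bold>\<box> \<^bold>\<sim> \<^bold>\<sim> \<phi> \<in> M \<longleftrightarrow> \<^bold>\<box> \<phi> \<in> M" if "\<phi> \<in> Fmm" for \<phi>
    using in_M[OF Tm_schemas.DN1, of \<phi>] that by auto
  have "to_m \<phi> \<in> M" if "\<phi> \<in> IDM4_axioms UNIV" for \<phi>
    using that by cases auto
  moreover have "to_m \<phi> \<in> M" if "\<phi> \<in> Tm_schemas Disj Conj Iff UNIV" for \<phi>
    using that by cases (auto intro: K K1 M1 T)
  \<comment> \<open>A boxed conjunction unfolds by (K2) and (DN1). A boxed disjunction is a boxed
    implication, and so is a box over a negated conjunction, up to (DN1); (M1) introduces them, (K)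
    and (K1) eliminate them.\<close>
  moreover have "to_m \<phi> \<in> M" if "\<phi> \<in> IvFDE_extra_axioms" for \<phi>
    using that by cases (auto intro: M1 dest: K K1)
  ultimately show ?thesis
    using E by (auto simp: model_def IvFDE_T_def)
qed

lemma Tm_sub: "Tm \<subseteq> Fmm"
proof
  fix \<phi> assume "\<phi> \<in> Tm"
  then show "\<phi> \<in> Fmm"
    unfolding Tm_def by cases auto
qed

text \<open>In (K2), (M1) and (DN1) the defined connectives stand only outside \<box>. Hence it
  suffices that they agree truth-functionally with the primitive ones in every model, and
  completeness turns this into derivability.\<close>

lemma derives_Tm:
  assumes L: "IvFDE_T \<subseteq> L" and \<phi>: "\<phi> \<in> Tm"
  shows "\<Gamma> \<turnstile>\<^bsub>L\<^esub> \<phi>"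
proof (rule ccontr)
  interpret classical_calculus UNIV L
    by (rule classical_calculus_IDM4) (use L in \<open>auto simp: IvFDE_T_def\<close>)
  assume "\<not> (\<Gamma> \<turnstile>\<^bsub>L\<^esub> \<phi>)"
  then obtain M where M: "model UNIV L M" "\<phi> \<notin> M"
    using completeness by (metis UNIV_I subset_UNIV)
  have Ax: "IDM4_axioms UNIV \<subseteq> L" "Tm_schemas Disj Conj Iff UNIV \<subseteq> L"
    using L by (auto simp: IvFDE_T_def)
  have in_M: "\<phi> \<in> M" if "\<phi> \<in> Tm_schemas Disj Conj Iff UNIV" for \<phi>
    using that Ax model.Ax_in[OF M(1)] by auto
  \<comment> \<open>The underivable axiom \<phi> is itself the formula outside \<open>M\<close> that
    makes \<sim> classical.\<close>
  note simps = model.Imp_in[OF M(1)] Conj_in[OF M(1) Ax(1)] Disj_in[OF M(1) Ax(1)]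
    Comp_in[OF M(1) Ax(2) _ _ _ M(2)]
  have iff: "\<phi> \<in> M \<longleftrightarrow> \<psi> \<in> M" if "\<phi> \<^bold>\<leftrightarrow> \<psi> \<in> Tm_schemas Disj Conj Iff UNIV" for \<phi> \<psi>
    using in_M[OF that] by (auto simp: simps)
  have "\<phi> \<in> M"
    using \<phi>[unfolded Tm_def]
  proof cases
    case (K2 \<phi> \<psi>)
    then show ?thesis
      using iff[OF Tm_schemas.K2[of \<phi> UNIV \<psi>]] by (auto simp: simps)
  next
    case (M1 \<phi> \<psi>)
    then show ?thesis
      using in_M[OF Tm_schemas.M1[of \<phi> UNIV \<psi>]] by (auto simp: simps)
  next
    case (DN1 \<phi>)
    then show ?thesis
      using iff[OF Tm_schemas.DN1[of \<phi>]] by (auto simp: simps)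
  qed (auto intro: in_M Tm_schemas.intros)
  then show False
    using M by blast
qed

text \<open>\<open>E' \<subseteq> E\<close> serves the direction from the small calculus to the
  large one. For the converse, \<open>to_m\<close> sends \<open>E\<close> into \<open>E'\<close>, so
  a countermodel of the small calculus pulls back along \<open>to_m\<close>, which fixes \<Gamma>
  and \<phi>.\<close>

lemma conservative_Tm:
  assumes E: "to_m ` E = E'" "E' \<subseteq> E" and \<Gamma>: "\<Gamma> \<subseteq> Fmm" and \<phi>: "\<phi> \<in> Fmm"
  shows "(\<Gamma> \<turnstile>\<^bsub>IvFDE_T \<union> E\<^esub> \<phi>) \<longleftrightarrow> (\<Gamma> \<turnstile>\<^bsub>Tm \<union> E'\<^esub> \<phi>)"
proof
  assume "\<Gamma> \<turnstile>\<^bsub>Tm \<union> E'\<^esub> \<phi>"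
  then show "\<Gamma> \<turnstile>\<^bsub>IvFDE_T \<union> E\<^esub> \<phi>"
  proof (rule derives_mono)
    show "\<Gamma> \<turnstile>\<^bsub>IvFDE_T \<union> E\<^esub> \<alpha>" if "\<alpha> \<in> Tm \<union> E'" for \<alpha>
      using that E by (auto intro: derives.axiom derives_Tm)
  qed simp
next
  assume der: "\<Gamma> \<turnstile>\<^bsub>IvFDE_T \<union> E\<^esub> \<phi>"
  interpret classical_calculus Fmm "Tm \<union> E'"
    by (rule classical_calculus_Tm) (use Tm_sub E(1) in auto)
  show "\<Gamma> \<turnstile>\<^bsub>Tm \<union> E'\<^esub> \<phi>"
  proof (rule ccontr)
    assume "\<not> (\<Gamma> \<turnstile>\<^bsub>Tm \<union> E'\<^esub> \<phi>)"
    then obtain M where M: "model Fmm (Tm \<union> E') M" "\<Gamma> \<subseteq> M" "\<phi> \<notin> M"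
      using completeness \<Gamma> \<phi> by metis
    have "model UNIV (IvFDE_T \<union> E) {\<phi>. to_m \<phi> \<in> M}"
      by (rule model_to_m[OF M(1) _ \<phi> M(3)]) (use model.Ax_in[OF M(1)] E(1) in auto)
    moreover have "\<Gamma> \<subseteq> {\<phi>. to_m \<phi> \<in> M}"
      using \<Gamma> M(2) by (auto simp: to_m_id subset_iff)
    ultimately have "to_m \<phi> \<in> M"
      using model_sound[OF der] by blast
    then show False
      using M(3) \<phi> by (simp add: to_m_id)
  qed
qed

lemma to_m_image: "range to_m = Fmm"
proof
  show "Fmm \<subseteq> range to_m"
    using to_m_id by (metis rangeI subsetI)
qed auto

text \<open>Each schema is built from \<rightarrow>, \<sim> and \<box>, with which
  \<open>to_m\<close> commutes, and its letter ranges over \<open>Fmm\<close>, the range of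
  \<open>to_m\<close>.\<close>

lemma to_m_axioms:
  "to_m ` axioms_4 UNIV = axioms_4 Fmm" "axioms_4 Fmm \<subseteq> axioms_4 UNIV"
  "to_m ` axioms_5 UNIV = axioms_5 Fmm" "axioms_5 Fmm \<subseteq> axioms_5 UNIV"
  "to_m ` axioms_B UNIV = axioms_B Fmm" "axioms_B Fmm \<subseteq> axioms_B UNIV"
  unfolding axioms_4_def axioms_5_def axioms_B_def to_m_image[symmetric] setcompr_eq_image
  by (auto simp: image_image)

theorem mainTheorem12:
  shows "(\<forall>L \<in> {IvFDE_T4, IvFDE_T45, IvFDE_TB, IvFDE_T4B, IvFDE_T5}.
            \<forall>\<Gamma> \<phi>. \<Gamma> \<union> {\<phi>} \<subseteq> Fm4 \<longrightarrow> ((\<Gamma> \<turnstile>\<^bsub>L\<^esub> \<phi>) \<longleftrightarrow> (\<Gamma> \<turnstile>\<^bsub>IDM4\<^esub> \<phi>)))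
       \<and> (\<forall>\<Gamma> \<phi>. \<Gamma> \<union> {\<phi>} \<subseteq> Fmm \<longrightarrow>
            ((\<Gamma> \<turnstile>\<^bsub>IvFDE_T4\<^esub> \<phi>) \<longleftrightarrow> (\<Gamma> \<turnstile>\<^bsub>T4m\<^esub> \<phi>))
          \<and> ((\<Gamma> \<turnstile>\<^bsub>IvFDE_T45\<^esub> \<phi>) \<longleftrightarrow> (\<Gamma> \<turnstile>\<^bsub>T45m\<^esub> \<phi>))
          \<and> ((\<Gamma> \<turnstile>\<^bsub>IvFDE_TB\<^esub> \<phi>) \<longleftrightarrow> (\<Gamma> \<turnstile>\<^bsub>TBm\<^esub> \<phi>))
          \<and> ((\<Gamma> \<turnstile>\<^bsub>IvFDE_T4B\<^esub> \<phi>) \<longleftrightarrow> (\<Gamma> \<turnstile>\<^bsub>T4Bm\<^esub> \<phi>))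
          \<and> ((\<Gamma> \<turnstile>\<^bsub>IvFDE_T5\<^esub> \<phi>) \<longleftrightarrow> (\<Gamma> \<turnstile>\<^bsub>T5m\<^esub> \<phi>)))"
proof (intro conjI ballI allI impI)
  fix L \<Gamma> \<phi>
  assume "L \<in> {IvFDE_T4, IvFDE_T45, IvFDE_TB, IvFDE_T4B, IvFDE_T5}" and "\<Gamma> \<union> {\<phi>} \<subseteq> Fm4"
  then show "(\<Gamma> \<turnstile>\<^bsub>L\<^esub> \<phi>) \<longleftrightarrow> (\<Gamma> \<turnstile>\<^bsub>IDM4\<^esub> \<phi>)"
    by (intro conservative_IDM4)
      (auto simp: IvFDE_T4_def IvFDE_T45_def IvFDE_TB_def IvFDE_T4B_def IvFDE_T5_def IvFDE_T_def)
next
  fix \<Gamma> \<phi>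
  assume "\<Gamma> \<union> {\<phi>} \<subseteq> Fmm"
  then have F: "\<Gamma> \<subseteq> Fmm" "\<phi> \<in> Fmm"
    by auto
  note axioms_Un = image_Un to_m_axioms
  show "(\<Gamma> \<turnstile>\<^bsub>IvFDE_T4\<^esub> \<phi>) \<longleftrightarrow> (\<Gamma> \<turnstile>\<^bsub>T4m\<^esub> \<phi>)"
    unfolding IvFDE_T4_def T4m_def by (intro conservative_Tm F to_m_axioms)
  show "(\<Gamma> \<turnstile>\<^bsub>IvFDE_T45\<^esub> \<phi>) \<longleftrightarrow> (\<Gamma> \<turnstile>\<^bsub>T45m\<^esub> \<phi>)"
    unfolding IvFDE_T45_def T45m_def Un_assoc
    by (intro conservative_Tm F Un_mono to_m_axioms) (simp add: axioms_Un)
  show "(\<Gamma> \<turnstile>\<^bsub>IvFDE_TB\<^esub> \<phi>) \<longleftrightarrow> (\<Gamma> \<turnstile>\<^bsub>TBm\<^esub> \<phi>)"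
    unfolding IvFDE_TB_def TBm_def by (intro conservative_Tm F to_m_axioms)
  show "(\<Gamma> \<turnstile>\<^bsub>IvFDE_T4B\<^esub> \<phi>) \<longleftrightarrow> (\<Gamma> \<turnstile>\<^bsub>T4Bm\<^esub> \<phi>)"
    unfolding IvFDE_T4B_def T4Bm_def Un_assoc
    by (intro conservative_Tm F Un_mono to_m_axioms) (simp add: axioms_Un)
  show "(\<Gamma> \<turnstile>\<^bsub>IvFDE_T5\<^esub> \<phi>) \<longleftrightarrow> (\<Gamma> \<turnstile>\<^bsub>T5m\<^esub> \<phi>)"
    unfolding IvFDE_T5_def T5m_def by (intro conservative_Tm F to_m_axioms)
qed

end
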